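(* Let $\varrho\colon C\to[0,1]$ be a default risk measure, and assume that $C$ contains an ordered subset. Then the following statements are equivalent. \begin{enumerate} \item[(i)] $\varrho$ is law-invariant and $\varrho(X)=\varrho\big(\mathbf 1_{\{X>0\}}\big)$ for all $X\in C$. \item[(ii)] There exists a nondecreasing distortion function $T\colon[0,1]\to[0,1]$ with \[ \varrho(X)=T\big(\mathbb{P}(X>0)\big)\quad\text{for all }X\in C. \] \end{enumerate}
   Context: $(\Omega,\mathcal F,\mathbb{P})$ is a probability space and $\mathrm{B}_{\mathrm b}$ is the space of all bounded measurable functions $\Omega\to\mathbb{R}$, ordered pointwise; real constants are identified with constant functions. $C\subset \mathrm{B}_{\mathrm b}$ is a set containing all constant functions and satisfying $\mathbf 1_{\{X>0\}}\in C$ for all $X\in C$. A map $\varrho\colon C\to[0,1]$ is a default risk measure if (i) $\varrho(X)\le\varrho(Y)$ for all $X,Y\in C$ with $X\le Y$, and (ii) $\varrho(0)=0$ and $\varrho(m)=1$ for all real $m>0$. It is law-invariant if $\varrho(X)=\varrho(Y)$ whenever $X,Y\in C$ have the same distribution under $\mathbb{P}$. Let $P:=\{p\in[0,1]\mid \exists X\in C\colon \mathbb{P}(X>0)=p\}$. The set $C$ contains an ordered subset if there exists a family $(X_p)_{p\in P}$ in $C$ with $\mathbb{P}(X_p>0)=p$ for all $p\in P$ and $\{X_p>0\}\subset\{X_q>0\}$ for all $p,q\in P$ with $p\le q$. A distortion function is a function $T\colon[0,1]\to[0,1]$ with $T(0)=0$ and $T(1)=1$. *)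

theory Defs
  imports "HOL-Probability.Probability"
begin

text \<open>
  A function on the sample space \<^term>\<open>space M\<close> is represented by a total HOL function; its values
  outside \<^term>\<open>space M\<close> carry no meaning. Boundedness, the pointwise order and distributions therefore
  only refer to \<^term>\<open>space M\<close>.
\<close>

definition bounded_measurable :: "'a measure \<Rightarrow> ('a \<Rightarrow> real) set" where
  "bounded_measurable M = {X \<in> borel_measurable M. bounded (X ` space M)}"

definition pos_event :: "'a measure \<Rightarrow> ('a \<Rightarrow> real) \<Rightarrow> 'a set" where
  "pos_event M X = {\<omega> \<in> space M. X \<omega> > 0}"

definition default_risk_measure ::
    "'a measure \<Rightarrow> ('a \<Rightarrow> real) set \<Rightarrow> (('a \<Rightarrow> real) \<Rightarrow> real) \<Rightarrow> bool" where
  "default_risk_measure M C \<rho> \<longleftrightarrow>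
     \<rho> \<in> C \<rightarrow> {0..1} \<and>
     (\<forall>X\<in>C. \<forall>Y\<in>C. (\<forall>\<omega>\<in>space M. X \<omega> \<le> Y \<omega>) \<longrightarrow> \<rho> X \<le> \<rho> Y) \<and>
     \<rho> (\<lambda>_. 0) = 0 \<and> (\<forall>m>0. \<rho> (\<lambda>_. m) = 1)"

definition law_invariant ::
    "'a measure \<Rightarrow> ('a \<Rightarrow> real) set \<Rightarrow> (('a \<Rightarrow> real) \<Rightarrow> real) \<Rightarrow> bool" where
  "law_invariant M C \<rho> \<longleftrightarrow>
     (\<forall>X\<in>C. \<forall>Y\<in>C. distr M borel X = distr M borel Y \<longrightarrow> \<rho> X = \<rho> Y)"

definition pos_probs :: "'a measure \<Rightarrow> ('a \<Rightarrow> real) set \<Rightarrow> real set" where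
  "pos_probs M C = {p \<in> {0..1}. \<exists>X\<in>C. measure M (pos_event M X) = p}"

definition contains_ordered_subset :: "'a measure \<Rightarrow> ('a \<Rightarrow> real) set \<Rightarrow> bool" where
  "contains_ordered_subset M C \<longleftrightarrow>
     (\<exists>X :: real \<Rightarrow> 'a \<Rightarrow> real.
        (\<forall>p\<in>pos_probs M C. X p \<in> C \<and> measure M (pos_event M (X p)) = p) \<and>
        (\<forall>p\<in>pos_probs M C. \<forall>q\<in>pos_probs M C.
           p \<le> q \<longrightarrow> pos_event M (X p) \<subseteq> pos_event M (X q)))"

text \<open>Only the restriction of \<^term>\<open>T\<close> to the unit interval is meaningful.\<close>

definition distortion_function :: "(real \<Rightarrow> real) \<Rightarrow> bool" where
  "distortion_function T \<longleftrightarrow> T \<in> {0..1} \<rightarrow> {0..1} \<and> T 0 = 0 \<and> T 1 = 1"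

end

theory Submission
  imports Defs
begin

text \<open>
  Under (i), the value of the measure at \<open>X\<close> is that of the indicator of \<open>{X > 0}\<close>, whose law is
  determined by the probability of \<open>{X > 0}\<close>. Events of the ordered subset with the same
  probabilities may be substituted, and their nesting together with monotonicity shows that a
  larger probability gives a larger value. The distortion function is then the smallest
  nondecreasing extension, from the attained probabilities to the unit interval.
\<close>

lemma pos_event_indicator:
  "A \<subseteq> space M \<Longrightarrow> pos_event M (indicat_real A) = A"
  by (auto simp: pos_event_def indicator_def split: if_splits)

lemma pos_event_sets: "X \<in> borel_measurable M \<Longrightarrow> pos_event M X \<in> sets M"
  unfolding pos_event_def by measurable

lemma pos_event_subset_space: "pos_event M X \<subseteq> space M"
  by (auto simp: pos_event_def)

text \<open>The event \<open>X > 0\<close> is the preimage of a fixed Borel set, so its probability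
  depends on \<open>X\<close> only through its law. This is what makes any function of that
  probability law-invariant.\<close>

lemma measure_pos_event_eq_distr:
  "X \<in> borel_measurable M \<Longrightarrow> measure M (pos_event M X) = measure (distr M borel X) {0<..}"
  by (subst measure_distr) (auto simp: pos_event_def intro!: arg_cong[where f = "measure M"])

text \<open>A preimage under an indicator depends only on which of 0 and 1 lie in \<open>S\<close>.
  It is the whole space, the event, its complement or empty, and each of these has a probability
  fixed by that of the event.\<close>

lemma (in prob_space) distr_indicator_cong:
  assumes A: "A \<in> events" and B: "B \<in> events" and eq: "prob A = prob B"
  shows "distr M borel (indicat_real A) = distr M borel (indicat_real B)"
proof (rule measure_eqI)
  fix S assume "S \<in> sets (distr M borel (indicat_real A))"
  then have S: "S \<in> sets borel" by simp
  have vimage: "indicat_real D -` S \<inter> space M =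
      (if 1 \<in> S then if 0 \<in> S then space M else D else if 0 \<in> S then space M - D else {})"
    if "D \<in> events" for D
    using sets.sets_into_space[OF that] by (auto simp: indicator_def of_bool_def split: if_splits)
  have "prob (indicat_real A -` S \<inter> space M) = prob (indicat_real B -` S \<inter> space M)"
    using eq by (simp add: vimage A B prob_compl)
  then show "emeasure (distr M borel (indicat_real A)) S = emeasure (distr M borel (indicat_real B)) S"
    using A B S by (simp add: emeasure_distr emeasure_eq_measure)
qed simp

text \<open>An inequality of probabilities gives no pointwise comparison of \<open>X\<close> and
  \<open>Y\<close>. The ordered family supplies one, since its positivity events are nested.\<close>

lemma law_invariant_mono_pos_prob:
  assumes "prob_space M"
    and C: "C \<subseteq> borel_measurable M"
    and ind: "\<And>X. X \<in> C \<Longrightarrow> indicat_real (pos_event M X) \<in> C"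
    and mono: "\<And>X Y. X \<in> C \<Longrightarrow> Y \<in> C \<Longrightarrow> (\<And>\<omega>. \<omega> \<in> space M \<Longrightarrow> X \<omega> \<le> Y \<omega>) \<Longrightarrow> \<rho> X \<le> \<rho> Y"
    and "contains_ordered_subset M C"
    and law: "law_invariant M C \<rho>"
    and pos: "\<And>X. X \<in> C \<Longrightarrow> \<rho> X = \<rho> (indicat_real (pos_event M X))"
    and X: "X \<in> C" and Y: "Y \<in> C"
    and le: "measure M (pos_event M X) \<le> measure M (pos_event M Y)"
  shows "\<rho> X \<le> \<rho> Y"
proof -
  interpret prob_space M by fact
  obtain Z where Z: "\<And>p. p \<in> pos_probs M C \<Longrightarrow> Z p \<in> C \<and> prob (pos_event M (Z p)) = p"
    and nested: "\<And>p q. p \<in> pos_probs M C \<Longrightarrow> q \<in> pos_probs M C \<Longrightarrow> p \<le> q \<Longrightarrow>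
      pos_event M (Z p) \<subseteq> pos_event M (Z q)"
    using \<open>contains_ordered_subset M C\<close> unfolding contains_ordered_subset_def by metis
  define p q where "p = prob (pos_event M X)" and "q = prob (pos_event M Y)"
  have p: "p \<in> pos_probs M C" and q: "q \<in> pos_probs M C"
    using X Y by (auto simp: p_def q_def pos_probs_def)
  \<comment> \<open>\<open>V\<close> and \<open>W\<close> may have different laws; only their
    indicators share one, so law-invariance is applied to the indicators.\<close>
  have subst: "\<rho> W = \<rho> (indicat_real (pos_event M V))"
    if "W \<in> C" "V \<in> C" "prob (pos_event M V) = prob (pos_event M W)" for V W
  proof -
    have "distr M borel (indicat_real (pos_event M W)) = distr M borel (indicat_real (pos_event M V))"
      using that C by (intro distr_indicator_cong) (auto intro: pos_event_sets)
    then have "\<rho> (indicat_real (pos_event M W)) = \<rho> (indicat_real (pos_event M V))"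
      using law ind[OF that(1)] ind[OF that(2)] unfolding law_invariant_def by blast
    with pos[OF that(1)] show ?thesis
      by (rule trans)
  qed
  have "\<rho> X = \<rho> (indicat_real (pos_event M (Z p)))"
    using X Z[OF p] by (intro subst) (auto simp: p_def)
  also have "\<dots> \<le> \<rho> (indicat_real (pos_event M (Z q)))"
    using Z[OF p] Z[OF q] nested[OF p q] le
    by (intro mono ind) (auto simp: indicator_def p_def q_def)
  also have "\<dots> = \<rho> Y"
    using Y Z[OF q] by (intro subst[symmetric]) (auto simp: q_def)
  finally show ?thesis .
qed

theorem theorem47:
  fixes M :: "'a measure"
    and C :: "('a \<Rightarrow> real) set"
    and \<rho> :: "('a \<Rightarrow> real) \<Rightarrow> real"
  assumes "prob_space M"
    and "C \<subseteq> bounded_measurable M"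
    and "\<And>c :: real. (\<lambda>_. c) \<in> C"
    and "\<And>X. X \<in> C \<Longrightarrow> indicat_real (pos_event M X) \<in> C"
    and "default_risk_measure M C \<rho>"
    and "contains_ordered_subset M C"
  shows "(law_invariant M C \<rho> \<and> (\<forall>X\<in>C. \<rho> X = \<rho> (indicat_real (pos_event M X))))
     \<longleftrightarrow> (\<exists>T :: real \<Rightarrow> real. distortion_function T \<and> mono_on {0..1} T \<and>
            (\<forall>X\<in>C. \<rho> X = T (measure M (pos_event M X))))"
proof -
  interpret prob_space M by fact
  have C: "C \<subseteq> borel_measurable M"
    using assms(2) by (auto simp: bounded_measurable_def)
  have range: "\<rho> X \<in> {0..1}" if "X \<in> C" for X
    using assms(5) that by (auto simp: default_risk_measure_def)
  have mono: "\<rho> X \<le> \<rho> Y" if "X \<in> C" "Y \<in> C" "\<And>\<omega>. \<omega> \<in> space M \<Longrightarrow> X \<omega> \<le> Y \<omega>" for X Y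
    using assms(5) that by (auto simp: default_risk_measure_def)
  have zero: "\<rho> (\<lambda>_. 0) = 0" and one: "\<rho> (\<lambda>_. 1) = 1"
    using assms(5) by (auto simp: default_risk_measure_def)
  have pos_zero: "pos_event M (\<lambda>_. 0) = {}" and pos_one: "pos_event M (\<lambda>_. 1) = space M"
    by (auto simp: pos_event_def)
  show ?thesis
  proof
    assume i: "law_invariant M C \<rho> \<and> (\<forall>X\<in>C. \<rho> X = \<rho> (indicat_real (pos_event M X)))"
    have le: "\<rho> X \<le> \<rho> Y"
      if "X \<in> C" "Y \<in> C" "prob (pos_event M X) \<le> prob (pos_event M Y)" for X Y
      using i by (intro law_invariant_mono_pos_prob[OF assms(1) C assms(4) mono assms(6)] that) blast+
    \<comment> \<open>The bound \<open>\<le> p\<close> rather than equality keeps \<open>A p\<close>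
      nonempty for every \<open>p \<ge> 0\<close>, attained or not: it contains the constant 0. With
      the upper bound 1 on \<open>\<rho>\<close>, the supremum is then meaningful.\<close>
    define A where "A p = {X \<in> C. prob (pos_event M X) \<le> p}" for p
    define T where "T p = (SUP X\<in>A p. \<rho> X)" for p
    have bdd: "bdd_above (\<rho> ` A p)" for p
      using range by (intro bdd_aboveI[where M = 1]) (auto simp: A_def)
    have zero_in: "(\<lambda>_. 0) \<in> A p" if "0 \<le> p" for p
      using assms(3) that by (simp add: A_def pos_zero)
    \<comment> \<open>At an attained probability the supremum is a maximum: \<open>X\<close> itself
      competes, and by \<open>le\<close> no competitor exceeds it.\<close>
    have T: "T (prob (pos_event M X)) = \<rho> X" if "X \<in> C" for X
      unfolding T_def using that le by (intro cSup_eq_maximum) (auto simp: A_def)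
    have T_mono: "T p \<le> T q" if "0 \<le> p" "p \<le> q" for p q
      unfolding T_def using that zero_in[of p] bdd
      by (intro cSUP_subset_mono) (auto simp: A_def)
    have T0: "T 0 = 0"
      using T[OF assms(3)[of 0]] by (simp add: pos_zero zero)
    have T1: "T 1 = 1"
      using T[OF assms(3)[of 1]] by (simp add: pos_one one prob_space)
    \<comment> \<open>Monotonicity traps the values between \<open>T 0 = 0\<close> and
      \<open>T 1 = 1\<close>.\<close>
    have "T \<in> {0..1} \<rightarrow> {0..1}"
      using T_mono[of 0] T_mono[of _ 1] by (auto simp: T0 T1)
    then show "\<exists>T. distortion_function T \<and> mono_on {0..1} T \<and>
        (\<forall>X\<in>C. \<rho> X = T (prob (pos_event M X)))"
      using T T0 T1 T_mono by (intro exI[of _ T]) (auto simp: distortion_function_def mono_on_def)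
  next
    assume "\<exists>T. distortion_function T \<and> mono_on {0..1} T \<and>
        (\<forall>X\<in>C. \<rho> X = T (prob (pos_event M X)))"
    then obtain T where T: "\<And>X. X \<in> C \<Longrightarrow> \<rho> X = T (prob (pos_event M X))"
      by blast
    have "law_invariant M C \<rho>"
      using C by (auto simp: law_invariant_def T measure_pos_event_eq_distr subset_iff)
    \<comment> \<open>\<open>X\<close> and its indicator are positive on the same event, so
      \<open>T\<close> is evaluated at the same point.\<close>
    moreover have "\<rho> X = \<rho> (indicat_real (pos_event M X))" if "X \<in> C" for X
      using that assms(4) by (simp add: T pos_event_indicator pos_event_subset_space)
    ultimately show "law_invariant M C \<rho> \<and> (\<forall>X\<in>C. \<rho> X = \<rho> (indicat_real (pos_event M X)))"
      by blast
  qed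
qed

end
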